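(* Let $(\mathcal{M},\boldsymbol{g})$ be a four-dimensional, oriented and time-oriented space-time of signature $(+,-,-,-)$, let $\boldsymbol{F}\in\Omega^2(\mathcal{M})$ be a smooth, everywhere regular 2-form and let $\tilde{\boldsymbol{g}}=-\kappa_g^{-1}\left(\boldsymbol{F}^{2_g}+\frac{\psi_g}{2}\boldsymbol{g}\right)$. Let $\boldsymbol{X}$ be a vector field of wrench observers for $\boldsymbol{F}$ in $(\mathcal{M},\boldsymbol{g})$ with wrench 3-vector field $\boldsymbol{W}$, and put $\boldsymbol{l}=\frac{1}{\sqrt2}(\boldsymbol{X}+\boldsymbol{W})$, $\boldsymbol{n}=\frac1{\sqrt2}(\boldsymbol{X}-\boldsymbol{W})$. Let $\rho,p,\boldsymbol{q},\boldsymbol{\Pi}$ be the energy density, pressure, heat flux and anisotropic pressure of $\boldsymbol{F}$ in $(\mathcal{M},\boldsymbol{g})$ with respect to the observer $\boldsymbol{X}$, and let $\tilde\rho,\tilde p,\tilde{\boldsymbol{q}},\tilde{\boldsymbol{\Pi}}$ be the corresponding quantities of $\boldsymbol{F}$ in $(\mathcal{M},\tilde{\boldsymbol{g}})$ with respect to the observer $\tilde{\boldsymbol{X}}=\boldsymbol{W}$. Then $$\tilde\rho=\rho,\qquad \tilde p=p,\qquad \tilde{\boldsymbol{q}}=\boldsymbol{q}=0,\qquad \tilde{\boldsymbol{\Pi}}=\boldsymbol{\Pi}-\frac43\kappa_g\left(\boldsymbol{l}^{\flat_g}\otimes\boldsymbol{n}^{\flat_g}+\boldsymbol{n}^{\f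lat_g}\otimes\boldsymbol{l}^{\flat_g}\right).$$
   Context: Conventions. For a Lorentzian metric $\boldsymbol{h}$ of signature $(+,-,-,-)$ on the oriented 4-manifold $\mathcal{M}$, with $h=\det(h_{ab})$ in positively oriented coordinates and $[abcd]$ the Levi-Civita permutation symbol with $[0123]=1$, the Hodge dual of a 2-form $\boldsymbol{G}$ is $\star_{h}G_{ab}=\frac12\sqrt{-h}\,[abcd](h^{-1})^{cp}(h^{-1})^{dq}G_{pq}$ (the same orientation is used for all metrics), and the inner product of 2-forms is $\langle\boldsymbol{G},\boldsymbol{H}\rangle_h=\frac12(h^{-1})^{ac}(h^{-1})^{bd}G_{ab}H_{cd}$. Also $(\boldsymbol{F}^{2_h})_{ab}=F_{ac}(h^{-1})^{cd}F_{db}$. Invariants of $\boldsymbol{F}$: $\psi_h=\langle\boldsymbol{F},\boldsymbol{F}\rangle_h$, $\phi_h=\langle\boldsymbol{F},\star_h\boldsymbol{F}\rangle_h$, $\kappa_h=\frac12\sqrt{\psi_h^2+\phi_h^2}$. $\boldsymbol{F}$ is regular if $\kappa_g\neq0$; then $\tilde{\boldsymbol{g}}$ is a Lorentzian metric of signature $(+,-,-,-)$. For a vector $\boldsymbol{V}$, $\boldsymbol{V}^{\flat_h}=\boldsymbol{h}(\cdot,\boldsymbol{V})$ and $(i_{\boldsymbol{V}}\boldsymbol{F})_a=V^bF_{ba}$. An observer in $(\mathcal{M},\boldsymbol{h})$ is a (future-directed) vector $\boldsymbol{Y}$ with $\boldsymbol{h}(\boldsymbol{Y},\boldsymbol{Y})=1$;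 the electric and magnetic 3-vectors $\boldsymbol{E},\boldsymbol{B}\in\boldsymbol{Y}^{\perp_h}$ it measures are defined by $\boldsymbol{E}^{\flat_h}=-i_{\boldsymbol{Y}}\boldsymbol{F}$, $\boldsymbol{B}^{\flat_h}=i_{\boldsymbol{Y}}\star_h\boldsymbol{F}$, and $E^2=-\boldsymbol{h}(\boldsymbol{E},\boldsymbol{E})$, $B^2=-\boldsymbol{h}(\boldsymbol{B},\boldsymbol{B})$. $\boldsymbol{Y}$ is a wrench observer, with wrench 3-vector $\boldsymbol{W}$, if $\boldsymbol{W}\in\boldsymbol{Y}^{\perp_h}$, $\boldsymbol{h}(\boldsymbol{W},\boldsymbol{W})=-1$ and $\boldsymbol{E}=\alpha\boldsymbol{W}$, $\boldsymbol{B}=\beta\boldsymbol{W}$ for real scalars $\alpha,\beta$. (One has $\tilde{\boldsymbol{g}}(\boldsymbol{W},\boldsymbol{W})=1$, and the future in $(\mathcal{M},\tilde{\boldsymbol{g}})$ is chosen, by convention, to be given by the direction of $\boldsymbol{W}$. The paper fixes the sign of $\boldsymbol{W}$ by requiring $\alpha>0$ if $\psi_g\le0$ and $\beta>0$ if $\psi_g>0$; the identities do not depend on this choice.) Hydrodynamic quantities of $\boldsymbol{F}$ in $(\mathcal{M},\boldsymbol{h})$ with respect to the observer $\boldsymbol{Y}$: with the projector $\boldsymbol{P}=\boldsymbol{h}-\boldsymbol{Y}^{\flat_h}\otimes\boldsymbol{Y}^{\flat_h}$, $$\rho=\tfrac12(E^2+B^2),\quad p=\tfrac16(E^2+B^2),\quad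 \boldsymbol{q}^{\flat_h}=-i_{\boldsymbol{Y}}\star_h(\boldsymbol{E}^{\flat_h}\wedge\boldsymbol{B}^{\flat_h}),$$ $$\boldsymbol{\Pi}=-\boldsymbol{E}^{\flat_h}\otimes\boldsymbol{E}^{\flat_h}-\boldsymbol{B}^{\flat_h}\otimes\boldsymbol{B}^{\flat_h}-\tfrac13(E^2+B^2)\boldsymbol{P}.$$ These are the coefficients in the decomposition of the energy-momentum tensor $\boldsymbol{F}^{2_h}+\frac{\psi_h}{2}\boldsymbol{h}=\rho\,\boldsymbol{Y}^{\flat_h}\otimes\boldsymbol{Y}^{\flat_h}-p\,\boldsymbol{P}+\boldsymbol{q}^{\flat_h}\otimes\boldsymbol{Y}^{\flat_h}+\boldsymbol{Y}^{\flat_h}\otimes\boldsymbol{q}^{\flat_h}+\boldsymbol{\Pi}$. *)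

theory Defs
  imports "HOL-Analysis.Analysis"
begin

section \<open>Oriented smooth 4-manifolds and tensor fields in components\<close>

text \<open>Iterated Frechet derivatives, one direction at a time. In finite dimension (and for open
  \<open>S\<close>) this is the usual notion of a \<open>C\<^sup>k\<close> function.\<close>

primrec Ck_on :: "nat \<Rightarrow> 'a::real_normed_vector set \<Rightarrow> ('a \<Rightarrow> 'b::real_normed_vector) \<Rightarrow> bool" where
  "Ck_on 0 S f \<longleftrightarrow> continuous_on S f"
| "Ck_on (Suc k) S f \<longleftrightarrow> (\<forall>x\<in>S. f differentiable (at x)) \<and>
     (\<forall>v. Ck_on k S (\<lambda>x. frechet_derivative f (at x) v))"

definition smooth_on :: "'a::real_normed_vector set \<Rightarrow> ('a \<Rightarrow> 'b::real_normed_vector) \<Rightarrow> bool" where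
  "smooth_on S f \<longleftrightarrow> (\<forall>k. Ck_on k S f)"

text \<open>A chart is a domain together with a coordinate map. The index type \<open>4\<close> consists of
  \<open>0, 1, 2, 3\<close> (with \<open>4 = 0\<close>), so coordinates are numbered from \<open>0\<close> to \<open>3\<close>.\<close>

type_synonym 'a chart = "'a set \<times> ('a \<Rightarrow> real^4)"

definition chart_inv :: "'a chart \<Rightarrow> real^4 \<Rightarrow> 'a" where
  "chart_inv c = inv_into (fst c) (snd c)"

definition transition :: "'a chart \<Rightarrow> 'a chart \<Rightarrow> real^4 \<Rightarrow> real^4" where
  "transition c c' = snd c' \<circ> chart_inv c"

definition transition_jacobian :: "'a chart \<Rightarrow> 'a chart \<Rightarrow> 'a \<Rightarrow> real^4^4" where
  "transition_jacobian c c' x = jacobian (transition c c') (at (snd c x))"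

definition is_chart :: "'a topology \<Rightarrow> 'a chart \<Rightarrow> bool" where
  "is_chart M c \<longleftrightarrow> openin M (fst c) \<and> open (snd c ` fst c) \<and>
     homeomorphic_map (subtopology M (fst c)) (top_of_set (snd c ` fst c)) (snd c)"

definition oriented_smooth_atlas :: "'a topology \<Rightarrow> 'a chart set \<Rightarrow> bool" where
  "oriented_smooth_atlas M A \<longleftrightarrow>
     (\<forall>c\<in>A. is_chart M c) \<and> (\<Union>c\<in>A. fst c) = topspace M \<and>
     (\<forall>c\<in>A. \<forall>c'\<in>A. smooth_on (snd c ` (fst c \<inter> fst c')) (transition c c') \<and>
        (\<forall>x\<in>fst c \<inter> fst c'. det (transition_jacobian c c' x) > 0))"

definition oriented_smooth_4_manifold :: "'a topology \<Rightarrow> 'a chart set \<Rightarrow> bool" where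
  "oriented_smooth_4_manifold M A \<longleftrightarrow>
     Hausdorff_space M \<and> second_countable M \<and> oriented_smooth_atlas M A"

text \<open>A tensor field is given by its components in every chart of the atlas, subject to the
  transformation law. Only charts in the atlas and points in their domains matter. Vectors and
  covectors are both elements of \<^typ>\<open>real^4\<close>; covariant 2-tensors are matrices \<open>t\<close> with
  \<open>t $ a $ b\<close> the component \<open>t\<^sub>a\<^sub>b\<close>.\<close>

type_synonym 'a vector_comps = "'a chart \<Rightarrow> 'a \<Rightarrow> real^4"
type_synonym 'a tensor_comps = "'a chart \<Rightarrow> 'a \<Rightarrow> real^4^4"

definition vector_field :: "'a chart set \<Rightarrow> 'a vector_comps \<Rightarrow> bool" where
  "vector_field A V \<longleftrightarrow> (\<forall>c\<in>A. \<forall>c'\<in>A. \<forall>x\<in>fst c \<inter> fst c'.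
     V c' x = transition_jacobian c c' x *v V c x)"

definition covariant_2_tensor_field :: "'a chart set \<Rightarrow> 'a tensor_comps \<Rightarrow> bool" where
  "covariant_2_tensor_field A t \<longleftrightarrow> (\<forall>c\<in>A. \<forall>c'\<in>A. \<forall>x\<in>fst c \<inter> fst c'.
     t c x = transpose (transition_jacobian c c' x) ** t c' x ** transition_jacobian c c' x)"

definition continuous_comps ::
    "'a chart set \<Rightarrow> ('a chart \<Rightarrow> 'a \<Rightarrow> 'b::real_normed_vector) \<Rightarrow> bool" where
  "continuous_comps A t \<longleftrightarrow> (\<forall>c\<in>A. continuous_on (snd c ` fst c) (t c \<circ> chart_inv c))"

definition smooth_comps ::
    "'a chart set \<Rightarrow> ('a chart \<Rightarrow> 'a \<Rightarrow> 'b::real_normed_vector) \<Rightarrow> bool" where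
  "smooth_comps A t \<longleftrightarrow> (\<forall>c\<in>A. smooth_on (snd c ` fst c) (t c \<circ> chart_inv c))"

definition smooth_2_form :: "'a chart set \<Rightarrow> 'a tensor_comps \<Rightarrow> bool" where
  "smooth_2_form A G \<longleftrightarrow> covariant_2_tensor_field A G \<and> smooth_comps A G \<and>
     (\<forall>c\<in>A. \<forall>x\<in>fst c. transpose (G c x) = - G c x)"

section \<open>Algebra in one tangent space, in positively oriented components\<close>

definition minkowski :: "real^4^4" where
  "minkowski = (\<chi> a b. if a = b then (if a = 0 then 1 else - 1) else 0)"

text \<open>Signature \<open>(+,-,-,-)\<close>: the columns of \<open>P\<close> form an orthonormal basis. Symmetry is implied.\<close>

definition lorentzian :: "real^4^4 \<Rightarrow> bool" where
  "lorentzian h \<longleftrightarrow> (\<exists>P. invertible P \<and> transpose P ** h ** P = minkowski)"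

definition metric_app :: "real^4^4 \<Rightarrow> real^4 \<Rightarrow> real^4 \<Rightarrow> real" where
  "metric_app h U V = (\<Sum>a\<in>UNIV. \<Sum>b\<in>UNIV. h $ a $ b * U $ a * V $ b)"

definition flat :: "real^4^4 \<Rightarrow> real^4 \<Rightarrow> real^4" where
  "flat h V = h *v V"

definition sharp :: "real^4^4 \<Rightarrow> real^4 \<Rightarrow> real^4" where
  "sharp h w = matrix_inv h *v w"

lemma flat_eq_iff_eq_sharp:
  assumes "invertible h"
  shows "flat h V = w \<longleftrightarrow> V = sharp h w"
proof -
  have "\<exists>k. h ** k = mat 1 \<and> k ** h = mat 1"
    using assms by (simp add: invertible_def)
  then have "h ** matrix_inv h = mat 1 \<and> matrix_inv h ** h = mat 1"
    unfolding matrix_inv_def by (rule someI_ex)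
  then show ?thesis
    by (auto simp: flat_def sharp_def matrix_vector_mul_assoc)
qed

definition tensor :: "real^4 \<Rightarrow> real^4 \<Rightarrow> real^4^4" where
  "tensor u v = (\<chi> a b. u $ a * v $ b)"

definition wedge :: "real^4 \<Rightarrow> real^4 \<Rightarrow> real^4^4" where
  "wedge u v = tensor u v - tensor v u"

definition interior_mult :: "real^4 \<Rightarrow> real^4^4 \<Rightarrow> real^4" where
  "interior_mult V G = (\<chi> a. \<Sum>b\<in>UNIV. V $ b * G $ b $ a)"

definition levi_civita :: "4 \<Rightarrow> 4 \<Rightarrow> 4 \<Rightarrow> 4 \<Rightarrow> real" where
  "levi_civita a b c d =
     (if distinct [a, b, c, d]
      then of_int (sign (\<lambda>i::4. if i = 0 then a else if i = 1 then b else if i = 2 then c else d))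
      else 0)"

lemma levi_civita_0123: "levi_civita 0 1 2 3 = 1"
proof -
  have "(\<lambda>i::4. if i = 0 then 0 else if i = 1 then 1 else if i = 2 then 2 else 3) = id"
  proof
    fix i :: 4
    have "i = 1 \<or> i = 2 \<or> i = 3 \<or> i = 0"
    proof -
      have "(4::4) = 0" by simp
      with exhaust_4[of i] show ?thesis by metis
    qed
    then show "(if i = 0 then 0 else if i = 1 then 1 else if i = 2 then 2 else 3) = id i"
      by auto
  qed
  then show ?thesis
    by (simp add: levi_civita_def)
qed

definition hodge :: "real^4^4 \<Rightarrow> real^4^4 \<Rightarrow> real^4^4" where
  "hodge h G = (\<chi> a b. 1 / 2 * sqrt (- det h) *
     (\<Sum>c\<in>UNIV. \<Sum>d\<in>UNIV. \<Sum>p\<in>UNIV. \<Sum>q\<in>UNIV.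
        levi_civita a b c d * matrix_inv h $ c $ p * matrix_inv h $ d $ q * G $ p $ q))"

definition form_inner :: "real^4^4 \<Rightarrow> real^4^4 \<Rightarrow> real^4^4 \<Rightarrow> real" where
  "form_inner h G H = 1 / 2 *
     (\<Sum>a\<in>UNIV. \<Sum>b\<in>UNIV. \<Sum>c\<in>UNIV. \<Sum>d\<in>UNIV.
        matrix_inv h $ a $ c * matrix_inv h $ b $ d * G $ a $ b * H $ c $ d)"

definition form_square :: "real^4^4 \<Rightarrow> real^4^4 \<Rightarrow> real^4^4" where
  "form_square h F = F ** matrix_inv h ** F"

definition psi :: "real^4^4 \<Rightarrow> real^4^4 \<Rightarrow> real" where
  "psi h F = form_inner h F F"

definition phi :: "real^4^4 \<Rightarrow> real^4^4 \<Rightarrow> real" where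
  "phi h F = form_inner h F (hodge h F)"

definition kappa :: "real^4^4 \<Rightarrow> real^4^4 \<Rightarrow> real" where
  "kappa h F = 1 / 2 * sqrt ((psi h F)\<^sup>2 + (phi h F)\<^sup>2)"

definition tilde_metric :: "real^4^4 \<Rightarrow> real^4^4 \<Rightarrow> real^4^4" where
  "tilde_metric g F = - inverse (kappa g F) *\<^sub>R (form_square g F + (psi g F / 2) *\<^sub>R g)"

subsection \<open>Observers and hydrodynamic quantities\<close>

definition electric :: "real^4^4 \<Rightarrow> real^4^4 \<Rightarrow> real^4 \<Rightarrow> real^4" where
  "electric h F Y = sharp h (- interior_mult Y F)"

definition magnetic :: "real^4^4 \<Rightarrow> real^4^4 \<Rightarrow> real^4 \<Rightarrow> real^4" where
  "magnetic h F Y = sharp h (interior_mult Y (hodge h F))"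

definition electric_sq :: "real^4^4 \<Rightarrow> real^4^4 \<Rightarrow> real^4 \<Rightarrow> real" where
  "electric_sq h F Y = - metric_app h (electric h F Y) (electric h F Y)"

definition magnetic_sq :: "real^4^4 \<Rightarrow> real^4^4 \<Rightarrow> real^4 \<Rightarrow> real" where
  "magnetic_sq h F Y = - metric_app h (magnetic h F Y) (magnetic h F Y)"

definition wrench_vector :: "real^4^4 \<Rightarrow> real^4^4 \<Rightarrow> real^4 \<Rightarrow> real^4 \<Rightarrow> bool" where
  "wrench_vector h F Y W \<longleftrightarrow> metric_app h W Y = 0 \<and> metric_app h W W = - 1 \<and>
     (\<exists>\<alpha> \<beta>. electric h F Y = \<alpha> *\<^sub>R W \<and> magnetic h F Y = \<beta> *\<^sub>R W)"

definition projector :: "real^4^4 \<Rightarrow> real^4 \<Rightarrow> real^4^4" where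
  "projector h Y = h - tensor (flat h Y) (flat h Y)"

definition energy_density :: "real^4^4 \<Rightarrow> real^4^4 \<Rightarrow> real^4 \<Rightarrow> real" where
  "energy_density h F Y = 1 / 2 * (electric_sq h F Y + magnetic_sq h F Y)"

definition pressure :: "real^4^4 \<Rightarrow> real^4^4 \<Rightarrow> real^4 \<Rightarrow> real" where
  "pressure h F Y = 1 / 6 * (electric_sq h F Y + magnetic_sq h F Y)"

definition heat_flux :: "real^4^4 \<Rightarrow> real^4^4 \<Rightarrow> real^4 \<Rightarrow> real^4" where
  "heat_flux h F Y = sharp h (- interior_mult Y
     (hodge h (wedge (flat h (electric h F Y)) (flat h (magnetic h F Y)))))"

definition anisotropic_pressure :: "real^4^4 \<Rightarrow> real^4^4 \<Rightarrow> real^4 \<Rightarrow> real^4^4" where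
  "anisotropic_pressure h F Y =
     - tensor (flat h (electric h F Y)) (flat h (electric h F Y))
     - tensor (flat h (magnetic h F Y)) (flat h (magnetic h F Y))
     - (1 / 3 * (electric_sq h F Y + magnetic_sq h F Y)) *\<^sub>R projector h Y"

section \<open>Space-times and fields of observers\<close>

text \<open>A time orientation is represented by a continuous timelike vector field \<open>T\<close>.\<close>

definition spacetime ::
    "'a topology \<Rightarrow> 'a chart set \<Rightarrow> 'a tensor_comps \<Rightarrow> 'a vector_comps \<Rightarrow> bool" where
  "spacetime M A g T \<longleftrightarrow> oriented_smooth_4_manifold M A \<and>
     covariant_2_tensor_field A g \<and> smooth_comps A g \<and> (\<forall>c\<in>A. \<forall>x\<in>fst c. lorentzian (g c x)) \<and>
     vector_field A T \<and> continuous_comps A T \<and>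
     (\<forall>c\<in>A. \<forall>x\<in>fst c. metric_app (g c x) (T c x) (T c x) > 0)"

definition regular_2_form :: "'a chart set \<Rightarrow> 'a tensor_comps \<Rightarrow> 'a tensor_comps \<Rightarrow> bool" where
  "regular_2_form A g F \<longleftrightarrow> smooth_2_form A F \<and> (\<forall>c\<in>A. \<forall>x\<in>fst c. kappa (g c x) (F c x) \<noteq> 0)"

definition observer_field ::
    "'a chart set \<Rightarrow> 'a tensor_comps \<Rightarrow> 'a vector_comps \<Rightarrow> 'a vector_comps \<Rightarrow> bool" where
  "observer_field A g T Y \<longleftrightarrow> vector_field A Y \<and> smooth_comps A Y \<and>
     (\<forall>c\<in>A. \<forall>x\<in>fst c. metric_app (g c x) (Y c x) (Y c x) = 1 \<and>
        metric_app (g c x) (T c x) (Y c x) > 0)"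

text \<open>No continuity of the wrench 3-vector field is required: when its sign is normalised by
  \<open>\<alpha> > 0\<close> for \<open>\<psi> \<le> 0\<close> and \<open>\<beta> > 0\<close> for \<open>\<psi> > 0\<close>, it may jump where \<open>\<psi>\<close> changes sign.\<close>

definition wrench_observer_field ::
    "'a chart set \<Rightarrow> 'a tensor_comps \<Rightarrow> 'a vector_comps \<Rightarrow> 'a tensor_comps \<Rightarrow>
     'a vector_comps \<Rightarrow> 'a vector_comps \<Rightarrow> bool" where
  "wrench_observer_field A g T F Y W \<longleftrightarrow> observer_field A g T Y \<and> vector_field A W \<and>
     (\<forall>c\<in>A. \<forall>x\<in>fst c. wrench_vector (g c x) (F c x) (Y c x) (W c x))"

end

(* Everything is pointwise linear algebra. The observer X and the wrench vector W are orthonormal, so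
   they extend to a positively oriented g-orthonormal frame (X, W, y, z), in which
   F = alpha e^0 ^ e^1 - beta e^2 ^ e^3, hence kappa = (alpha^2 + beta^2) / 2 and the tilde metric
   is diag(-1, 1, -1, -1), that is g - 2 X^flat (x) X^flat + 2 W^flat (x) W^flat. Exchanging the roles
   of X and W, the observer W measures E = -alpha X and B = -beta X in the tilde metric. All the
   quantities involved are natural under orientation-preserving changes of frame, and the claims
   follow from these frame-independent formulas. *)
theory Submission
  imports Defs
begin

section \<open>The Levi-Civita symbol\<close>

text \<open>Numerals of the index type are read modulo 4, so an enumeration of the indices as 1, 2,
  3, 4 becomes the coordinate numbering 0 to 3 once this equation is applied.\<close>

lemma four_eq_zero: "(4::4) = 0" by simp

lemma all_index4: "(\<forall>i::4. Q i) \<longleftrightarrow> Q 0 \<and> Q 1 \<and> Q 2 \<and> Q 3"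
  using forall_4[of Q] unfolding four_eq_zero by blast

lemma sum_index4: "(\<Sum>i\<in>UNIV. f (i::4)) = f 0 + f 1 + f 2 + (f 3 :: 'a::comm_monoid_add)"
  unfolding sum_4 four_eq_zero by (simp only: ac_simps)

lemma prod_index4: "(\<Prod>i\<in>UNIV. f (i::4)) = f 0 * f 1 * f 2 * (f 3 :: 'a::comm_monoid_mult)"
  unfolding UNIV_4 four_eq_zero by (simp add: ac_simps)

text \<open>Names the map whose sign enters \<open>levi_civita\<close>, so that index quadruples and
  self-maps of the index type can be exchanged for each other.\<close>

definition tuple4 :: "4 \<Rightarrow> 4 \<Rightarrow> 4 \<Rightarrow> 4 \<Rightarrow> 4 \<Rightarrow> 4" where
  "tuple4 a b c d = (\<lambda>i. if i = 0 then a else if i = 1 then b else if i = 2 then c else d)"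

lemma tuple4_simps [simp]:
  "tuple4 a b c d 0 = a" "tuple4 a b c d 1 = b" "tuple4 a b c d 2 = c" "tuple4 a b c d 3 = d"
  by (simp_all add: tuple4_def)

lemma tuple4_eta: "tuple4 (p 0) (p 1) (p 2) (p 3) = p"
  by (simp add: fun_eq_iff all_index4)

lemma inj_tuple4: "inj (tuple4 a b c d) \<longleftrightarrow> distinct [a, b, c, d]"
  by (auto simp: inj_def all_index4)

lemma tuple4_permutes: "tuple4 a b c d permutes UNIV \<longleftrightarrow> distinct [a, b, c, d]"
proof -
  have "tuple4 a b c d permutes UNIV \<longleftrightarrow> inj (tuple4 a b c d)"
    by (auto intro: permutes_inj inj_imp_permutes)
  then show ?thesis by (simp only: inj_tuple4)
qed

lemma levi_civita_tuple4:
  "levi_civita a b c d =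
     (if tuple4 a b c d permutes UNIV then of_int (sign (tuple4 a b c d)) else 0)"
  unfolding tuple4_permutes by (simp add: levi_civita_def tuple4_def)

text \<open>This is the Leibniz formula: a permutation is the quadruple of its values, and
  quadruples with a repetition contribute zero because the symbol vanishes on them.\<close>

lemma det_eq_levi_civita_sum:
  fixes A :: "real^4^4"
  shows "det A = (\<Sum>i\<in>UNIV. \<Sum>j\<in>UNIV. \<Sum>k\<in>UNIV. \<Sum>l\<in>UNIV.
     levi_civita i j k l * A $ i $ 0 * A $ j $ 1 * A $ k $ 2 * A $ l $ 3)"
proof -
  let ?f = "\<lambda>p. of_int (sign p) * (\<Prod>i\<in>UNIV. A $ p i $ i)"
  let ?g = "\<lambda>i j k l. levi_civita i j k l * A $ i $ 0 * A $ j $ 1 * A $ k $ 2 * A $ l $ 3"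
  have "det A = (\<Sum>p | p permutes UNIV. ?f p)"
    \<comment> \<open>\<open>det_def\<close> lets the permutation act on the column index; passing
      to the transpose moves it to the row index.\<close>
    using det_transpose[of A] by (simp add: det_def transpose_def)
  also have "\<dots> = (\<Sum>(i, j, k, l) \<in> {(i, j, k, l). tuple4 i j k l permutes UNIV}. ?g i j k l)"
  proof (rule sum.reindex_bij_witness[where i = "\<lambda>(i, j, k, l). tuple4 i j k l"
        and j = "\<lambda>p. (p 0, p 1, p 2, p 3)"], goal_cases)
    case (5 p)
    then have "p permutes UNIV" by simp
    moreover have "(\<Prod>i\<in>UNIV. A $ p i $ i) = A $ p 0 $ 0 * A $ p 1 $ 1 * A $ p 2 $ 2 * A $ p 3 $ 3"
      by (simp only: prod_index4)
    ultimately show ?case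
      by (simp only: prod.case tuple4_eta levi_civita_tuple4 if_True mult.assoc)
  next
    case (1 p)
    show ?case by (simp only: prod.case tuple4_eta)
  next
    case (2 p)
    then show ?case by (simp add: tuple4_eta)
  next
    case (3 t)
    show ?case by (cases t) simp
  next
    case (4 t)
    then show ?case by (cases t) simp
  qed
  also have "\<dots> = (\<Sum>(i, j, k, l) \<in> UNIV. ?g i j k l)"
    by (rule sum.mono_neutral_left) (auto simp: levi_civita_tuple4 split: if_splits)
  also have "\<dots> = (\<Sum>i\<in>UNIV. \<Sum>j\<in>UNIV. \<Sum>k\<in>UNIV. \<Sum>l\<in>UNIV. ?g i j k l)"
    by (simp add: sum.cartesian_product flip: UNIV_Times_UNIV)
  finally show ?thesis .
qed

text \<open>The left side is the determinant of the matrix whose columns are the columns a, b, c, d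
  of \<open>A\<close>. Permuting columns produces the sign, and a repeated column produces zero.
  This is the source of the factor \<open>det P\<close> in the transformation of the Hodge
  dual.\<close>

lemma levi_civita_transform:
  fixes A :: "real^4^4"
  shows "(\<Sum>i\<in>UNIV. \<Sum>j\<in>UNIV. \<Sum>k\<in>UNIV. \<Sum>l\<in>UNIV.
     levi_civita i j k l * A $ i $ a * A $ j $ b * A $ k $ c * A $ l $ d) =
     det A * levi_civita a b c d"
proof -
  let ?B = "(\<chi> i j. A $ i $ tuple4 a b c d j) :: real^4^4"
  have "det ?B = det A * levi_civita a b c d"
  proof (cases "inj (tuple4 a b c d)")
    case True
    then have "tuple4 a b c d permutes UNIV"
      by (simp only: inj_tuple4 tuple4_permutes)
    then show ?thesis
      using det_permute_columns[of "tuple4 a b c d" A] by (simp add: levi_civita_tuple4 mult.commute)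
  next
    case False
    then obtain i j where "i \<noteq> j" "tuple4 a b c d i = tuple4 a b c d j"
      by (auto simp: inj_def)
    then have "det ?B = 0"
      by (intro det_identical_columns[of i j]) (auto simp: column_def)
    then show ?thesis
      using False by (simp only: levi_civita_tuple4 tuple4_permutes inj_tuple4) simp
  qed
  then show ?thesis
    by (simp add: det_eq_levi_civita_sum)
qed

text \<open>Exchanging two neighbouring indices composes the index map with a transposition, which
  reverses the sign.\<close>

lemma levi_civita_swap:
  "levi_civita b a c d = - levi_civita a b c d"
  "levi_civita a c b d = - levi_civita a b c d"
  "levi_civita a b d c = - levi_civita a b c d"
proof -
  have *: "levi_civita (p 0) (p 1) (p 2) (p 3) = - levi_civita a b c d"
    if "p = tuple4 a b c d \<circ> Transposition.transpose i j" "i \<noteq> j" for p i j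
  proof (cases "tuple4 a b c d permutes UNIV")
    case True
    have t: "Transposition.transpose i j permutes UNIV" by (simp add: permutes_swap_id)
    have "sign p = - sign (tuple4 a b c d)"
      unfolding that(1) using True t that(2)
      by (subst sign_compose) (auto simp: sign_swap_id permutes_imp_permutation)
    moreover have "p permutes UNIV"
      unfolding that(1) using t True by (rule permutes_compose)
    ultimately show ?thesis using True by (simp add: levi_civita_tuple4 tuple4_eta)
  next
    case False
    \<comment> \<open>A transposition is its own inverse, so if \<open>p\<close> were a permutation,
      the original index map would be one too; both symbols are therefore zero.\<close>
    have "tuple4 a b c d = p \<circ> Transposition.transpose i j"
      by (simp add: that(1) comp_assoc)
    then have "\<not> p permutes UNIV"
      using False permutes_compose[of "Transposition.transpose i j" UNIV p]
      by (auto simp: permutes_swap_id)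
    then show ?thesis using False by (simp add: levi_civita_tuple4 tuple4_eta)
  qed
  show "levi_civita b a c d = - levi_civita a b c d"
    using *[OF refl, of 0 1] by (simp add: Transposition.transpose_def)
  show "levi_civita a c b d = - levi_civita a b c d"
    using *[OF refl, of 1 2] by (simp add: Transposition.transpose_def)
  show "levi_civita a b d c = - levi_civita a b c d"
    using *[OF refl, of 2 3] by (simp add: Transposition.transpose_def)
qed

lemma levi_civita_repeated:
  "levi_civita a a c d = 0" "levi_civita a b a d = 0" "levi_civita a b c a = 0"
  "levi_civita a b b d = 0" "levi_civita a b c b = 0" "levi_civita a b c c = 0"
  by (simp_all add: levi_civita_def)

text \<open>Swapping only adjacent inversions sorts every index tuple, so the rewriting terminates.\<close>

lemma levi_civita_values:
  "levi_civita 0 1 2 3 = 1" "levi_civita 0 1 3 2 = - 1"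
  "levi_civita 0 2 1 3 = - 1" "levi_civita 0 2 3 1 = 1"
  "levi_civita 0 3 1 2 = 1" "levi_civita 0 3 2 1 = - 1"
  "levi_civita 1 0 2 3 = - 1" "levi_civita 1 0 3 2 = 1"
  "levi_civita 1 2 0 3 = 1" "levi_civita 1 2 3 0 = - 1"
  "levi_civita 1 3 0 2 = - 1" "levi_civita 1 3 2 0 = 1"
  "levi_civita 2 0 1 3 = 1" "levi_civita 2 0 3 1 = - 1"
  "levi_civita 2 1 0 3 = - 1" "levi_civita 2 1 3 0 = 1"
  "levi_civita 2 3 0 1 = 1" "levi_civita 2 3 1 0 = - 1"
  "levi_civita 3 0 1 2 = - 1" "levi_civita 3 0 2 1 = 1"
  "levi_civita 3 1 0 2 = 1" "levi_civita 3 1 2 0 = - 1"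
  "levi_civita 3 2 0 1 = - 1" "levi_civita 3 2 1 0 = 1"
  by (simp_all only: minus_minus levi_civita_0123
    levi_civita_swap(1)[of 1 0] levi_civita_swap(1)[of 2 0] levi_civita_swap(1)[of 2 1]
    levi_civita_swap(1)[of 3 0] levi_civita_swap(1)[of 3 1] levi_civita_swap(1)[of 3 2]
    levi_civita_swap(2)[of _ 1 0] levi_civita_swap(2)[of _ 2 0] levi_civita_swap(2)[of _ 2 1]
    levi_civita_swap(2)[of _ 3 0] levi_civita_swap(2)[of _ 3 1] levi_civita_swap(2)[of _ 3 2]
    levi_civita_swap(3)[of _ _ 1 0] levi_civita_swap(3)[of _ _ 2 0] levi_civita_swap(3)[of _ _ 2 1]
    levi_civita_swap(3)[of _ _ 3 0] levi_civita_swap(3)[of _ _ 3 1] levi_civita_swap(3)[of _ _ 3 2])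

section \<open>Change of frame\<close>

text \<open>When the columns of \<open>P\<close> form a frame, this gives the components of a
  covariant 2-tensor in that frame.\<close>

definition pullback :: "real^4^4 \<Rightarrow> real^4^4 \<Rightarrow> real^4^4" where
  "pullback P G = transpose P ** G ** P"

lemma matrix_add_rdistrib:
  fixes A B :: "'a::semiring_1^'n^'m"
  shows "(A + B) ** C = A ** C + B ** C"
  by (simp add: matrix_matrix_mult_def vec_eq_iff sum.distrib distrib_right)

text \<open>\<open>matrix_inv\<close> is a choice of two-sided inverse. For square matrices a right
  inverse is two-sided, and inverses are unique, so the choice is determined.\<close>

lemma matrix_inv_eqI:
  fixes A B :: "real^'n^'n"
  assumes "A ** B = mat 1"
  shows "matrix_inv A = B"
proof -
  have "\<exists>B'. A ** B' = mat 1 \<and> B' ** A = mat 1"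
    using assms matrix_left_right_inverse by blast
  then have "matrix_inv A ** A = mat 1"
    unfolding matrix_inv_def by (rule someI2_ex) simp
  then have "matrix_inv A ** (A ** B) = B"
    by (simp add: matrix_mul_assoc)
  then show ?thesis using assms by simp
qed

lemma matrix_inv_mult:
  fixes A :: "real^'n^'n"
  assumes "invertible A"
  shows "A ** matrix_inv A = mat 1" "matrix_inv A ** A = mat 1"
  using assms matrix_inv_eqI matrix_left_right_inverse unfolding invertible_def by metis+

lemma invertible_pullback:
  assumes "invertible P" "invertible h"
  shows "invertible (pullback P h)"
  using assms by (simp add: pullback_def invertible_mult transpose_invertible)

text \<open>The inverse metric is contravariant, so \<open>P\<close> carries its frame components
  forward to the original ones. The naturality of every operation that raises an index rests on
  this.\<close>

lemma matrix_inv_pullback: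
  assumes P: "invertible P" and h: "invertible h"
  shows "P ** matrix_inv (pullback P h) ** transpose P = matrix_inv h"
proof (rule matrix_inv_eqI[symmetric])
  let ?K = "matrix_inv (pullback P h)"
  have "transpose P ** (h ** P ** ?K) = mat 1"
    using matrix_inv_mult(1)[OF invertible_pullback[OF P h]]
    by (simp add: pullback_def matrix_mul_assoc)
  \<comment> \<open>A left factor of the identity is also a right factor, which moves
    \<open>transpose P\<close> from the front to the end.\<close>
  then have "h ** P ** ?K ** transpose P = mat 1"
    using matrix_left_right_inverse by blast
  then show "h ** (P ** ?K ** transpose P) = mat 1"
    by (simp add: matrix_mul_assoc)
qed

lemma metric_app_eq_inner: "metric_app h U V = U \<bullet> (h *v V)"
  by (simp add: metric_app_def inner_vec_def matrix_vector_mult_def sum_distrib_left mult_ac)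

lemma metric_app_pullback: "metric_app (pullback P h) U V = metric_app h (P *v U) (P *v V)"
proof -
  have "pullback P h *v V = (h *v (P *v V)) v* P"
    by (simp add: pullback_def flip: matrix_vector_mul_assoc)
  then show ?thesis
    by (simp add: metric_app_eq_inner inner_commute[of U] inner_commute[of "P *v U"] dot_lmul_matrix)
qed

lemma interior_mult_eq: "interior_mult V G = transpose G *v V"
  by (simp add: interior_mult_def matrix_vector_mult_def transpose_def vec_eq_iff mult.commute)

lemma interior_mult_pullback:
  "interior_mult V (pullback P G) = transpose P *v interior_mult (P *v V) G"
  by (simp add: interior_mult_eq pullback_def matrix_transpose_mul matrix_vector_mul_assoc
      matrix_mul_assoc)

lemma sharp_pullback:
  assumes "invertible P" "invertible h"
  shows "P *v sharp (pullback P h) (transpose P *v w) = sharp h w"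
  using matrix_inv_pullback[OF assms]
  by (simp add: sharp_def matrix_vector_mul_assoc matrix_mul_assoc del: transpose_matrix_vector)

text \<open>Written as a trace, the inner product can be handled by matrix algebra, and its
  invariance under a change of frame reduces to cyclicity.\<close>

lemma form_inner_eq_trace:
  "form_inner h G H = 1 / 2 * trace (transpose (matrix_inv h) ** G ** matrix_inv h ** transpose H)"
proof -
  let ?K = "matrix_inv h"
  let ?t = "\<lambda>a b c d. ?K $ a $ c * ?K $ b $ d * G $ a $ b * H $ c $ d"
  have "trace (transpose ?K ** G ** ?K ** transpose H) =
      (\<Sum>c\<in>UNIV. \<Sum>d\<in>UNIV. \<Sum>b\<in>UNIV. \<Sum>a\<in>UNIV. ?t a b c d)"
    by (simp add: trace_def matrix_matrix_mult_def transpose_def sum_distrib_left sum_distrib_right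
        mult_ac)
  \<comment> \<open>A single sum over tuples allows the order of summation to be permuted in one
    reindexing.\<close>
  also have "\<dots> = (\<Sum>(c, d, b, a)\<in>UNIV. ?t a b c d)"
    by (simp add: sum.cartesian_product flip: UNIV_Times_UNIV)
  also have "\<dots> = (\<Sum>(a, b, c, d)\<in>UNIV. ?t a b c d)"
    by (rule sum.reindex_bij_witness[where i = "\<lambda>(a, b, c, d). (c, d, b, a)"
          and j = "\<lambda>(c, d, b, a). (a, b, c, d)"]) auto
  also have "\<dots> = (\<Sum>a\<in>UNIV. \<Sum>b\<in>UNIV. \<Sum>c\<in>UNIV. \<Sum>d\<in>UNIV. ?t a b c d)"
    by (simp add: sum.cartesian_product flip: UNIV_Times_UNIV)
  finally show ?thesis by (simp add: form_inner_def)
qed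

lemma form_inner_pullback:
  assumes "invertible P" "invertible h"
  shows "form_inner (pullback P h) (pullback P G) (pullback P H) = form_inner h G H"
proof -
  let ?K = "matrix_inv (pullback P h)"
  have K: "P ** (?K ** transpose P) = matrix_inv h"
    using matrix_inv_pullback[OF assms] by (simp add: matrix_mul_assoc)
  have Kt: "P ** (transpose ?K ** transpose P) = transpose (matrix_inv h)"
    unfolding K[symmetric] by (simp add: matrix_transpose_mul matrix_mul_assoc)
  have "trace (transpose ?K ** pullback P G ** ?K ** transpose (pullback P H)) =
      trace ((transpose ?K ** transpose P ** G ** (P ** (?K ** transpose P)) ** transpose H) ** P)"
    by (simp add: pullback_def matrix_transpose_mul matrix_mul_assoc)
  \<comment> \<open>Cyclicity carries the last \<open>P\<close> to the front, where it completes
    \<open>transpose ?K ** transpose P\<close> to the transposed inverse of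
    \<open>h\<close>.\<close>
  also have "\<dots> =
      trace (P ** (transpose ?K ** transpose P ** G ** (P ** (?K ** transpose P)) ** transpose H))"
    by (rule trace_mul_sym)
  also have "\<dots> =
      trace ((P ** (transpose ?K ** transpose P)) ** G ** (P ** (?K ** transpose P)) ** transpose H)"
    by (simp add: matrix_mul_assoc)
  finally show ?thesis by (simp add: form_inner_eq_trace K Kt)
qed

section \<open>The Hodge dual under a change of frame\<close>

definition two_vector_dual :: "real^4^4 \<Rightarrow> real^4^4" where
  "two_vector_dual N = (\<chi> a b. \<Sum>c\<in>UNIV. \<Sum>d\<in>UNIV. levi_civita a b c d * N $ c $ d)"

text \<open>Separates the metric ingredients, namely the volume factor and the raising of both
  indices, from the contraction with the permutation symbol.\<close>

lemma hodge_eq_two_vector_dual: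
  "hodge h G = (1 / 2 * sqrt (- det h)) *\<^sub>R
     two_vector_dual (matrix_inv h ** G ** transpose (matrix_inv h))"
proof -
  have "(\<Sum>p\<in>UNIV. \<Sum>q\<in>UNIV. K $ c $ p * K $ d $ q * G $ p $ q) = (K ** G ** transpose K) $ c $ d"
    for K :: "real^4^4" and c d
    unfolding matrix_matrix_mult_def transpose_def
    by (subst sum.swap) (simp add: sum_distrib_left sum_distrib_right mult_ac)
  then show ?thesis
    by (simp add: hodge_def two_vector_dual_def vec_eq_iff mult.assoc flip: sum_distrib_left)
qed

text \<open>The pullback supplies two copies of \<open>P\<close> and the transformed
  \<open>N\<close> two more. Together they are the four columns contracted in
  \<open>levi_civita_transform\<close>.\<close>

lemma two_vector_dual_congruence:
  "pullback P (two_vector_dual (P ** N ** transpose P)) = det P *\<^sub>R two_vector_dual N"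
proof -
  have "pullback P (two_vector_dual (P ** N ** transpose P)) $ a $ b =
      (det P *\<^sub>R two_vector_dual N) $ a $ b" for a b
  proof -
    let ?t = "\<lambda>c d i j k l. N $ c $ d *
      (levi_civita i j k l * P $ i $ a * P $ j $ b * P $ k $ c * P $ l $ d)"
    have "pullback P (two_vector_dual (P ** N ** transpose P)) $ a $ b =
      (\<Sum>j\<in>UNIV. \<Sum>i\<in>UNIV. \<Sum>k\<in>UNIV. \<Sum>l\<in>UNIV. \<Sum>d\<in>UNIV. \<Sum>c\<in>UNIV.
        ?t c d i j k l)"
      unfolding pullback_def two_vector_dual_def matrix_matrix_mult_def transpose_def
      by (simp add: sum_distrib_left sum_distrib_right mult_ac)
    also have "\<dots> = (\<Sum>(j, i, k, l, d, c)\<in>UNIV. ?t c d i j k l)"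
      by (simp add: sum.cartesian_product flip: UNIV_Times_UNIV)
    also have "\<dots> = (\<Sum>(c, d, i, j, k, l)\<in>UNIV. ?t c d i j k l)"
      by (rule sum.reindex_bij_witness[where i = "\<lambda>(c, d, i, j, k, l). (j, i, k, l, d, c)"
            and j = "\<lambda>(j, i, k, l, d, c). (c, d, i, j, k, l)"]) auto
    also have "\<dots> =
      (\<Sum>c\<in>UNIV. \<Sum>d\<in>UNIV. \<Sum>i\<in>UNIV. \<Sum>j\<in>UNIV. \<Sum>k\<in>UNIV. \<Sum>l\<in>UNIV. ?t c d i j k l)"
      by (simp add: sum.cartesian_product flip: UNIV_Times_UNIV)
    also have "\<dots> =
      (\<Sum>c\<in>UNIV. \<Sum>d\<in>UNIV. N $ c $ d * (\<Sum>i\<in>UNIV. \<Sum>j\<in>UNIV. \<Sum>k\<in>UNIV. \<Sum>l\<in>UNIV.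
        levi_civita i j k l * P $ i $ a * P $ j $ b * P $ k $ c * P $ l $ d))"
      by (simp only: sum_distrib_left)
    also have "\<dots> = (det P *\<^sub>R two_vector_dual N) $ a $ b"
      unfolding levi_civita_transform two_vector_dual_def
      by (simp add: sum_distrib_left mult_ac)
    finally show ?thesis .
  qed
  then show ?thesis by (simp add: vec_eq_iff)
qed

text \<open>The volume factor scales by the absolute value of \<open>det P\<close>, the symbol by
  \<open>det P\<close> itself. They agree because the frame is positively oriented.\<close>

lemma hodge_pullback:
  assumes "invertible h" "det P > 0"
  shows "hodge (pullback P h) (pullback P G) = pullback P (hodge h G)"
proof -
  have P: "invertible P" using assms by (simp add: invertible_det_nz)
  let ?K = "matrix_inv (pullback P h)"
  let ?N = "?K ** pullback P G ** transpose ?K"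
  have K: "P ** ?K ** transpose P = matrix_inv h"
    using matrix_inv_pullback[OF P assms(1)] .
  have "P ** ?N ** transpose P = (P ** ?K ** transpose P) ** G ** transpose (P ** ?K ** transpose P)"
    by (simp add: pullback_def matrix_transpose_mul matrix_mul_assoc)
  then have N: "P ** ?N ** transpose P = matrix_inv h ** G ** transpose (matrix_inv h)"
    by (simp only: K)
  have "- det (pullback P h) = (det P)\<^sup>2 * (- det h)"
    by (simp add: pullback_def det_mul det_transpose power2_eq_square mult_ac)
  then have s: "sqrt (- det (pullback P h)) = det P * sqrt (- det h)"
    using assms(2) by (simp only: real_sqrt_mult real_sqrt_abs abs_of_pos)
  have "pullback P (hodge h G) =
      (1 / 2 * sqrt (- det h)) *\<^sub>R pullback P (two_vector_dual (P ** ?N ** transpose P))"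
    unfolding N hodge_eq_two_vector_dual
    by (simp add: pullback_def matrix_scalar_ac scalar_matrix_assoc)
  also have "\<dots> = hodge (pullback P h) (pullback P G)"
    unfolding two_vector_dual_congruence hodge_eq_two_vector_dual s by (simp add: mult_ac)
  finally show ?thesis by simp
qed

section \<open>Naturality of the measured fields, the invariants and the tilde metric\<close>

lemma electric_pullback:
  assumes "invertible P" "invertible h"
  shows "P *v electric (pullback P h) (pullback P F) Y = electric h F (P *v Y)"
proof -
  have "- (transpose P *v interior_mult (P *v Y) F) = transpose P *v - interior_mult (P *v Y) F"
    using matrix_vector_mult_scaleR[of "transpose P" "- 1" "interior_mult (P *v Y) F"]
    by (simp only: scaleR_minus1_left)
  then show ?thesis
    by (simp only: electric_def interior_mult_pullback sharp_pullback[OF assms])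
qed

lemma magnetic_pullback:
  assumes "det P > 0" "invertible h"
  shows "P *v magnetic (pullback P h) (pullback P F) Y = magnetic h F (P *v Y)"
  using sharp_pullback[OF _ assms(2)] assms
  by (simp add: magnetic_def hodge_pullback interior_mult_pullback invertible_det_nz)

lemma psi_pullback:
  assumes "invertible P" "invertible h"
  shows "psi (pullback P h) (pullback P F) = psi h F"
  by (simp add: psi_def form_inner_pullback assms)

lemma kappa_pullback:
  assumes "det P > 0" "invertible h"
  shows "kappa (pullback P h) (pullback P F) = kappa h F"
proof -
  have "invertible P" using assms by (simp add: invertible_det_nz)
  with assms show ?thesis
    by (simp add: kappa_def psi_pullback phi_def hodge_pullback form_inner_pullback)
qed

lemma form_square_pullback:
  assumes "invertible P" "invertible h"
  shows "form_square (pullback P h) (pullback P F) = pullback P (form_square h F)"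
  unfolding form_square_def matrix_inv_pullback[OF assms, symmetric]
  by (simp add: pullback_def matrix_mul_assoc)

lemma tilde_metric_pullback:
  assumes "det P > 0" "invertible h"
  shows "tilde_metric (pullback P h) (pullback P F) = pullback P (tilde_metric h F)"
proof -
  have "invertible P" using assms by (simp add: invertible_det_nz)
  moreover have "pullback P (a *\<^sub>R G) = a *\<^sub>R pullback P G" for a G
    by (simp add: pullback_def matrix_scalar_ac scalar_matrix_assoc)
  moreover have "pullback P (G + H) = pullback P G + pullback P H" for G H
    by (simp add: pullback_def matrix_add_ldistrib matrix_add_rdistrib)
  ultimately show ?thesis using assms
    by (simp only: tilde_metric_def kappa_pullback psi_pullback form_square_pullback)
qed

section \<open>Orthonormal frames\<close>

text \<open>Both metrics take this form in the adapted frame, with entries 1 or -1 and determinant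
  -1. Inverses, duals and measured fields are thus computed once for both.\<close>

definition diagonal_matrix :: "('n \<Rightarrow> real) \<Rightarrow> real^'n^'n" where
  "diagonal_matrix s = (\<chi> a b. if a = b then s a else 0)"

lemma diagonal_matrix_nth [simp]: "diagonal_matrix s $ a $ b = (if a = b then s a else 0)"
  by (simp add: diagonal_matrix_def)

lemma minkowski_diagonal: "minkowski = diagonal_matrix (\<lambda>a. if a = 0 then 1 else - 1)"
  by (simp add: minkowski_def diagonal_matrix_def)

lemma det_diagonal_matrix: "det (diagonal_matrix s) = prod s UNIV"
  using det_diagonal[of "diagonal_matrix s"] by simp

lemma matrix_inv_diagonal_matrix:
  assumes "\<And>a. s a * s a = 1"
  shows "matrix_inv (diagonal_matrix s) = diagonal_matrix s"
  by (rule matrix_inv_eqI)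
     (simp add: vec_eq_iff matrix_matrix_mult_def mat_def assms if_distrib[of "\<lambda>x. x * _"] cong: if_cong)

lemma hodge_diagonal_matrix:
  assumes "\<And>a. s a * s a = 1" "prod s UNIV = - 1"
  shows "hodge (diagonal_matrix s) G $ a $ b =
    1 / 2 * (\<Sum>c\<in>UNIV. \<Sum>d\<in>UNIV. levi_civita a b c d * s c * s d * G $ c $ d)"
  by (simp add: hodge_def matrix_inv_diagonal_matrix assms det_diagonal_matrix
      if_distrib[of "\<lambda>x. x * _"] if_distrib[of "\<lambda>x. _ * x"] cong: if_cong)

text \<open>The columns of the matrix that witnesses \<open>lorentzian\<close> are an orthonormal
  basis. Surjectivity gives every vector coordinates in it, so claims about the metric can be
  checked for the Minkowski form.\<close>

lemma lorentzian_coordinates: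
  assumes "lorentzian h"
  obtains Q where "surj ((*v) Q)"
    "\<And>u v :: real^4. metric_app h (Q *v u) (Q *v v) =
      u $ 0 * v $ 0 - u $ 1 * v $ 1 - u $ 2 * v $ 2 - u $ 3 * v $ 3"
proof -
  obtain Q where Q: "invertible Q" "pullback Q h = minkowski"
    using assms by (auto simp: lorentzian_def pullback_def)
  have "surj ((*v) Q)"
    using Q(1) matrix_right_invertible_surjective unfolding invertible_def by blast
  moreover have "metric_app h (Q *v u) (Q *v v) =
      u $ 0 * v $ 0 - u $ 1 * v $ 1 - u $ 2 * v $ 2 - u $ 3 * v $ 3" for u v
    unfolding metric_app_pullback[symmetric] Q(2)
    by (simp add: metric_app_def minkowski_def sum_index4)
  ultimately show thesis using that by blast
qed

lemma lorentzian_invertible: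
  assumes "lorentzian h"
  shows "invertible h"
proof -
  obtain Q where "transpose Q ** h ** Q = minkowski"
    using assms by (auto simp: lorentzian_def)
  then have "det (transpose Q ** h ** Q) = - 1"
    by (simp add: minkowski_diagonal det_diagonal_matrix prod_index4)
  then show ?thesis by (auto simp: det_mul invertible_det_nz)
qed

lemma lorentzian_metric_app_commute:
  assumes "lorentzian h"
  shows "metric_app h U V = metric_app h V U"
proof -
  obtain Q where Q: "surj ((*v) Q)"
    "\<And>u v :: real^4. metric_app h (Q *v u) (Q *v v) =
      u $ 0 * v $ 0 - u $ 1 * v $ 1 - u $ 2 * v $ 2 - u $ 3 * v $ 3"
    using lorentzian_coordinates[OF assms] by blast
  obtain u v where "U = Q *v u" "V = Q *v v" using Q(1) by (meson surjD)
  then show ?thesis by (simp add: Q(2) mult.commute)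
qed

text \<open>By the Cauchy-Schwarz inequality in the spatial directions.\<close>

lemma lorentzian_orthogonal_timelike:
  assumes "lorentzian h" "metric_app h X X > 0" "metric_app h X V = 0" "V \<noteq> 0"
  shows "metric_app h V V < 0"
proof -
  obtain Q where Q: "surj ((*v) Q)"
    "\<And>u v :: real^4. metric_app h (Q *v u) (Q *v v) =
      u $ 0 * v $ 0 - u $ 1 * v $ 1 - u $ 2 * v $ 2 - u $ 3 * v $ 3"
    using lorentzian_coordinates[OF assms(1)] by blast
  obtain x v where xv: "X = Q *v x" "V = Q *v v" using Q(1) by (meson surjD)
  have "v \<noteq> 0" using assms(4) xv by auto
  define a where "a = (x $ 1)\<^sup>2 + (x $ 2)\<^sup>2 + (x $ 3)\<^sup>2"
  define b where "b = (v $ 1)\<^sup>2 + (v $ 2)\<^sup>2 + (v $ 3)\<^sup>2"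
  define c where "c = x $ 1 * v $ 1 + x $ 2 * v $ 2 + x $ 3 * v $ 3"
  have 1: "(x $ 0)\<^sup>2 > a"
    using assms(2) by (simp add: xv Q(2) a_def power2_eq_square)
  have 2: "x $ 0 * v $ 0 = c"
    using assms(3) by (simp add: xv Q(2) c_def)
  have 3: "c\<^sup>2 \<le> a * b"
  proof -
    \<comment> \<open>Lagrange's identity exhibits the Cauchy-Schwarz defect as a sum of
      squares.\<close>
    have "a * b - c\<^sup>2 = (x $ 1 * v $ 2 - x $ 2 * v $ 1)\<^sup>2 + (x $ 1 * v $ 3 - x $ 3 * v $ 1)\<^sup>2
        + (x $ 2 * v $ 3 - x $ 3 * v $ 2)\<^sup>2"
      by (simp add: a_def b_def c_def power2_eq_square algebra_simps)
    then show ?thesis by (smt (verit) zero_le_power2)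
  qed
  have a: "a \<ge> 0" by (simp add: a_def)
  \<comment> \<open>If the spatial part of \<open>v\<close> vanished, orthogonality to the timelike
    \<open>x\<close>, whose time component is nonzero, would force \<open>v = 0\<close>.\<close>
  have b: "b > 0"
  proof (rule ccontr)
    assume "\<not> b > 0"
    then have "(v $ 1)\<^sup>2 = 0 \<and> (v $ 2)\<^sup>2 = 0 \<and> (v $ 3)\<^sup>2 = 0"
      unfolding b_def by (smt (verit) zero_le_power2)
    then have s: "v $ 1 = 0" "v $ 2 = 0" "v $ 3 = 0" by simp_all
    with 2 have "x $ 0 * v $ 0 = 0" by (simp add: c_def)
    moreover have "x $ 0 \<noteq> 0" using 1 a by auto
    ultimately have "v = 0" using s by (simp add: vec_eq_iff all_index4)
    with \<open>v \<noteq> 0\<close> show False ..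
  qed
  have "(x $ 0)\<^sup>2 * (v $ 0)\<^sup>2 \<le> a * b"
    using 2 3 by (simp flip: power_mult_distrib)
  also have "\<dots> < (x $ 0)\<^sup>2 * b" using 1 b by simp
  finally have "(v $ 0)\<^sup>2 < b" by (rule mult_left_less_imp_less) simp
  then show ?thesis by (simp add: xv Q(2) b_def power2_eq_square)
qed

lemma matrix_vector_mult_axis:
  fixes P :: "real^'n^'m"
  shows "P *v axis a 1 = column a P"
  by (simp add: matrix_vector_mult_basis)

lemma metric_app_axis: "metric_app h (axis a 1) (axis b 1) = h $ a $ b"
  by (simp add: metric_app_eq_inner matrix_vector_mult_axis inner_axis' column_def)

text \<open>Orthogonality to \<open>U\<close> for \<open>h\<close> is Euclidean orthogonality to
  \<open>transpose h *v U\<close>. With \<open>X\<close> there are at most three such conditions in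
  dimension four, so a nonzero solution exists; being orthogonal to \<open>X\<close> it is spacelike
  and can be normalised.\<close>

lemma lorentzian_unit_orthogonal:
  assumes h: "lorentzian h" "metric_app h X X = 1" and S: "finite S" "card S < 3"
  obtains V where "metric_app h V V = - 1" "metric_app h X V = 0" "\<And>U. U \<in> S \<Longrightarrow> metric_app h U V = 0"
proof -
  let ?S = "(\<lambda>U. transpose h *v U) ` insert X S"
  have "dim ?S \<le> card ?S" using S by (intro dim_le_card') auto
  also have "\<dots> \<le> card (insert X S)" using S by (intro card_image_le) auto
  also have "\<dots> < DIM(real^4)" using S by (auto simp: card_insert_if)
  finally obtain V where V: "V \<noteq> 0" "\<And>u. u \<in> span ?S \<Longrightarrow> orthogonal V u"
    using orthogonal_to_subspace_exists by blast
  have o: "metric_app h U V = 0" if "U \<in> insert X S" for U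
  proof -
    have "orthogonal V (transpose h *v U)" using that by (intro V(2) span_base) blast
    then show ?thesis
      by (simp add: orthogonal_def metric_app_eq_inner dot_lmul_matrix[symmetric] inner_commute)
  qed
  have neg: "metric_app h V V < 0"
    using lorentzian_orthogonal_timelike[OF h(1) _ o V(1), of X] h(2) by simp
  define r where "r = - metric_app h V V"
  define k where "k = 1 / sqrt r"
  have s: "metric_app h U (k *\<^sub>R V) = k * metric_app h U V" for U
    by (simp add: metric_app_eq_inner matrix_vector_mult_scaleR)
  have s': "metric_app h (k *\<^sub>R V) U = k * metric_app h V U" for U
    by (simp add: metric_app_eq_inner)
  have "k * (k * metric_app h V V) = - 1"
  proof -
    have r: "metric_app h V V = - (sqrt r * sqrt r)" "k * sqrt r = 1"
      using neg by (simp_all add: r_def k_def)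
    have "k * (k * metric_app h V V) = - ((k * sqrt r) * (k * sqrt r))"
      unfolding r(1) by (simp only: mult_minus_right ac_simps)
    then show ?thesis by (simp only: r(2) mult_1)
  qed
  then have "metric_app h (k *\<^sub>R V) (k *\<^sub>R V) = - 1"
    by (simp add: s s')
  with o show thesis by (intro that[of "k *\<^sub>R V"]) (auto simp: s)
qed

text \<open>Two orthogonal extensions complete \<open>X\<close> and \<open>W\<close> to an
  orthonormal basis, and the free sign of the last vector is used to fix the orientation.\<close>

lemma oriented_orthonormal_frame:
  assumes h: "lorentzian h" and X: "metric_app h X X = 1"
    and W: "metric_app h W W = - 1" "metric_app h W X = 0"
  obtains P where "det P > 0" "pullback P h = minkowski" "P *v axis 0 1 = X" "P *v axis 1 1 = W"
proof -
  note c = lorentzian_metric_app_commute[OF h]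
  obtain y where y: "metric_app h y y = - 1" "metric_app h X y = 0" "metric_app h W y = 0"
    using lorentzian_unit_orthogonal[OF h X, of "{W}"] by auto
  have "card {W, y} < 3" by (simp add: card_insert_if)
  then obtain z where z: "metric_app h z z = - 1" "metric_app h X z = 0" "metric_app h W z = 0"
      "metric_app h y z = 0"
    by (rule lorentzian_unit_orthogonal[OF h X, of "{W, y}", rotated]) simp_all
  \<comment> \<open>The factor \<open>k\<close> will be 1 or -1: either value keeps the frame
    orthonormal, and switching between them reverses the sign of the determinant.\<close>
  define P :: "real \<Rightarrow> real^4^4" where
    "P k = (\<chi> i j. if j = 0 then X $ i else if j = 1 then W $ i
      else if j = 2 then y $ i else k * z $ i)" for k
  have col: "column 0 (P k) = X" "column 1 (P k) = W" "column 2 (P k) = y" "column 3 (P k) = k *\<^sub>R z" for k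
    by (simp_all add: P_def column_def vec_eq_iff)
  have s: "metric_app h U (k *\<^sub>R V) = k * metric_app h U V"
     "metric_app h (k *\<^sub>R V) U = k * metric_app h V U" for U V k
    by (simp_all add: metric_app_eq_inner matrix_vector_mult_scaleR)
  have pb: "pullback (P k) h = minkowski" if "k * k = 1" for k
  proof -
    have "pullback (P k) h $ a $ b = metric_app h (column a (P k)) (column b (P k))" for a b
      by (simp add: metric_app_pullback matrix_vector_mult_axis flip: metric_app_axis)
    moreover have "metric_app h X W = 0" "metric_app h y X = 0" "metric_app h z X = 0"
      "metric_app h y W = 0" "metric_app h z W = 0" "metric_app h z y = 0"
      using c W y z by metis+
    ultimately show ?thesis
      using that by (simp add: vec_eq_iff all_index4 col minkowski_def s X W y z)
  qed
  have "det (pullback (P 1) h) = - 1"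
    by (simp add: pb minkowski_diagonal det_diagonal_matrix prod_index4)
  then have nz: "det (P 1) \<noteq> 0" by (auto simp: pullback_def det_mul)
  have "P (- 1) = P 1 ** diagonal_matrix (\<lambda>j. if j = 3 then - 1 else 1)"
    by (simp add: vec_eq_iff all_index4 matrix_matrix_mult_def sum_index4 P_def)
  then have "det (P (- 1)) = - det (P 1)"
    by (simp add: det_mul det_diagonal_matrix prod_index4)
  then obtain k where "k * k = 1" "det (P k) > 0"
    using nz by (cases "det (P 1) > 0") (auto intro: that[of 1] that[of "- 1"])
  then show thesis
    using that[of "P k"] pb by (simp add: matrix_vector_mult_axis col)
qed

section \<open>The field in an adapted frame\<close>

lemma electric_diagonal_matrix:
  assumes "\<And>a. s a * s a = 1"
  shows "electric (diagonal_matrix s) F (axis i 1) $ a = - s a * F $ i $ a"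
proof -
  have "electric (diagonal_matrix s) F (axis i 1) $ a =
      s a * (- interior_mult (axis i 1) F) $ a"
    by (simp add: electric_def sharp_def matrix_inv_diagonal_matrix assms matrix_vector_mult_def
      if_distrib[of "\<lambda>x. x * _"] del: vector_uminus_component cong: if_cong)
  then show ?thesis
    by (simp add: interior_mult_def axis_def if_distrib[of "\<lambda>x. x * _"] cong: if_cong)
qed

lemma magnetic_diagonal_matrix:
  assumes "\<And>a. s a * s a = 1"
  shows "magnetic (diagonal_matrix s) F (axis i 1) $ a = s a * hodge (diagonal_matrix s) F $ i $ a"
proof -
  have "magnetic (diagonal_matrix s) F (axis i 1) $ a =
      s a * interior_mult (axis i 1) (hodge (diagonal_matrix s) F) $ a"
    by (simp add: magnetic_def sharp_def matrix_inv_diagonal_matrix assms matrix_vector_mult_def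
      if_distrib[of "\<lambda>x. x * _"] cong: if_cong)
  then show ?thesis
    by (simp add: interior_mult_def axis_def if_distrib[of "\<lambda>x. x * _"] cong: if_cong)
qed

lemma form_inner_diagonal_matrix:
  assumes "\<And>a. s a * s a = 1"
  shows "form_inner (diagonal_matrix s) G H =
    1 / 2 * (\<Sum>a\<in>UNIV. \<Sum>b\<in>UNIV. s a * s b * G $ a $ b * H $ a $ b)"
  by (simp add: form_inner_def matrix_inv_diagonal_matrix assms
      if_distrib[of "\<lambda>x. x * _"] if_distrib[of "\<lambda>x. _ * x"] cong: if_cong)

lemma axis_nth_if: "axis i x $ j = (if j = i then x else 0)"
  by (simp add: axis_def)

text \<open>The signs are chosen so that the observer \<open>axis 0 1\<close> measures electric
  component \<alpha> and magnetic component \<beta> along \<open>axis 1 1\<close> in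
  \<open>minkowski\<close>: lowering a spatial index changes the sign, and the 01 component of the
  dual is the 23 component of the form.\<close>

definition wrench_form :: "real \<Rightarrow> real \<Rightarrow> real^4^4" where
  "wrench_form \<alpha> \<beta> = \<alpha> *\<^sub>R wedge (axis 0 1) (axis 1 1) - \<beta> *\<^sub>R wedge (axis 2 1) (axis 3 1)"

lemma wrench_form_nth:
  "wrench_form \<alpha> \<beta> $ a $ b =
    (if a = 0 \<and> b = 1 then \<alpha> else if a = 1 \<and> b = 0 then - \<alpha>
     else if a = 2 \<and> b = 3 then - \<beta> else if a = 3 \<and> b = 2 then \<beta> else 0)"
proof -
  have "\<forall>a b. wrench_form \<alpha> \<beta> $ a $ b =
    (if a = 0 \<and> b = 1 then \<alpha> else if a = 1 \<and> b = 0 then - \<alpha>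
     else if a = 2 \<and> b = 3 then - \<beta> else if a = 3 \<and> b = 2 then \<beta> else 0)"
    by (simp add: all_index4 wrench_form_def wedge_def tensor_def axis_def)
  then show ?thesis by blast
qed

text \<open>The electric vector determines row 0 of \<open>F\<close>, the magnetic vector row 0 of
  its dual. The latter holds the remaining independent components 23, 31 and 12, and antisymmetry
  supplies the rest.\<close>

lemma wrench_form_eqI:
  assumes F: "transpose F = - F"
    and E: "electric minkowski F (axis 0 1) = \<alpha> *\<^sub>R axis 1 1"
    and B: "magnetic minkowski F (axis 0 1) = \<beta> *\<^sub>R axis 1 1"
  shows "F = wrench_form \<alpha> \<beta>"
proof -
  have anti: "F $ b $ a = - F $ a $ b" for a b
    using arg_cong[OF F, of "\<lambda>G. G $ a $ b"] by (simp add: transpose_def)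
  have E': "- (if a = 0 then 1 else - 1) * F $ 0 $ a = (if a = 1 then \<alpha> else 0)" for a
    using arg_cong[OF E, of "\<lambda>V. V $ a"]
    by (subst (asm) minkowski_diagonal, subst (asm) electric_diagonal_matrix) (auto simp: axis_def)
  have B': "(if a = 0 then 1 else - 1) * hodge minkowski F $ 0 $ a = (if a = 1 then \<beta> else 0)" for a
    using arg_cong[OF B, of "\<lambda>V. V $ a"] unfolding minkowski_diagonal
    by (subst (asm) magnetic_diagonal_matrix) (auto simp: axis_def)
  have H: "hodge minkowski F $ 0 $ 1 = F $ 2 $ 3" "hodge minkowski F $ 0 $ 2 = F $ 3 $ 1"
    "hodge minkowski F $ 0 $ 3 = F $ 1 $ 2"
    unfolding minkowski_diagonal using anti[of 3 2] anti[of 1 3] anti[of 2 1]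
    by (simp_all add: hodge_diagonal_matrix prod_index4 sum_index4 levi_civita_values levi_civita_repeated)
  show ?thesis
    using E'[of 1] E'[of 2] E'[of 3] B'[of 1] B'[of 2] B'[of 3] H
      anti[of 0 0] anti[of 1 1] anti[of 2 2] anti[of 3 3]
      anti[of 0 1] anti[of 0 2] anti[of 0 3] anti[of 1 2] anti[of 1 3] anti[of 2 3]
    by (simp add: vec_eq_iff all_index4 wrench_form_nth)
qed

definition tilde_minkowski :: "real^4^4" where
  "tilde_minkowski = diagonal_matrix (\<lambda>a. if a = 1 then 1 else - 1)"

lemma wrench_form_psi: "psi minkowski (wrench_form \<alpha> \<beta>) = \<beta>\<^sup>2 - \<alpha>\<^sup>2"
  by (simp add: minkowski_diagonal psi_def form_inner_diagonal_matrix sum_index4 wrench_form_nth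
      power2_eq_square)

lemma wrench_form_phi: "phi minkowski (wrench_form \<alpha> \<beta>) = 2 * \<alpha> * \<beta>"
  by (simp add: minkowski_diagonal phi_def form_inner_diagonal_matrix hodge_diagonal_matrix
      prod_index4 sum_index4 wrench_form_nth levi_civita_values levi_civita_repeated)

text \<open>\<psi> and \<phi> are the real and imaginary parts of (\<beta> + i \<alpha>)^2, so the
  square root yields the squared modulus \<alpha>^2 + \<beta>^2.\<close>

lemma wrench_form_kappa: "kappa minkowski (wrench_form \<alpha> \<beta>) = (\<alpha>\<^sup>2 + \<beta>\<^sup>2) / 2"
proof -
  have "(\<beta>\<^sup>2 - \<alpha>\<^sup>2)\<^sup>2 + (2 * \<alpha> * \<beta>)\<^sup>2 = (\<alpha>\<^sup>2 + \<beta>\<^sup>2)\<^sup>2"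
    by (simp add: power2_eq_square algebra_simps)
  then show ?thesis
    by (simp add: kappa_def wrench_form_psi wrench_form_phi)
qed

lemma wrench_form_tilde_metric:
  assumes "kappa minkowski (wrench_form \<alpha> \<beta>) \<noteq> 0"
  shows "tilde_metric minkowski (wrench_form \<alpha> \<beta>) = tilde_minkowski"
proof -
  let ?F = "wrench_form \<alpha> \<beta>"
  have square: "form_square minkowski ?F = (\<chi> a b. if a = b then
      (if a = 0 then \<alpha>\<^sup>2 else if a = 1 then - \<alpha>\<^sup>2 else \<beta>\<^sup>2) else 0)"
    unfolding minkowski_diagonal form_square_def
    by (subst matrix_inv_diagonal_matrix)
       (simp_all add: vec_eq_iff all_index4 matrix_matrix_mult_def sum_index4 wrench_form_nth power2_eq_square)
  \<comment> \<open>Since \<psi> = \<beta>^2 - \<alpha>^2, the diagonal entries become \<kappa>,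
    -\<kappa>, \<kappa>, \<kappa>. Division by -\<kappa> leaves only signs.\<close>
  have "form_square minkowski ?F + (psi minkowski ?F / 2) *\<^sub>R minkowski =
      - kappa minkowski ?F *\<^sub>R tilde_minkowski"
    unfolding square wrench_form_psi wrench_form_kappa
    by (simp add: vec_eq_iff all_index4 minkowski_def tilde_minkowski_def field_simps)
  then show ?thesis
    using assms by (simp add: tilde_metric_def)
qed

text \<open>Compared with the observer \<open>axis 0 1\<close> in \<open>minkowski\<close>, the time
  and space indices 0 and 1 are interchanged. Antisymmetry of the form reverses the sign here, and
  antisymmetry of its dual does so for the magnetic vector.\<close>

lemma wrench_form_tilde_electric:
  "electric tilde_minkowski (wrench_form \<alpha> \<beta>) (axis 1 1) = - \<alpha> *\<^sub>R axis 0 1"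
  unfolding tilde_minkowski_def
  by (simp add: vec_eq_iff all_index4 electric_diagonal_matrix wrench_form_nth axis_nth_if)

lemma wrench_form_tilde_magnetic:
  "magnetic tilde_minkowski (wrench_form \<alpha> \<beta>) (axis 1 1) = - \<beta> *\<^sub>R axis 0 1"
  unfolding tilde_minkowski_def
  by (simp add: vec_eq_iff all_index4 magnetic_diagonal_matrix hodge_diagonal_matrix prod_index4
      sum_index4 levi_civita_values levi_civita_repeated wrench_form_nth axis_nth_if)

text \<open>Each correction flips one diagonal entry. Expressed through the covectors of the two
  frame vectors, the identity no longer refers to coordinates and can be carried to any
  frame.\<close>

lemma tilde_minkowski_eq:
  "tilde_minkowski = minkowski
    - 2 *\<^sub>R tensor (flat minkowski (axis 0 1)) (flat minkowski (axis 0 1))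
    + 2 *\<^sub>R tensor (flat minkowski (axis 1 1)) (flat minkowski (axis 1 1))"
  by (simp add: vec_eq_iff all_index4 tilde_minkowski_def minkowski_def tensor_def flat_def
      matrix_vector_mult_axis column_def)

section \<open>Transfer from the adapted frame back to arbitrary components\<close>

lemma pullback_inject:
  assumes "invertible P" "pullback P G = pullback P H"
  shows "G = H"
proof -
  let ?K = "matrix_inv P"
  have "transpose ?K ** transpose P ** G ** (P ** ?K) = G" for G
    using matrix_inv_mult[OF assms(1)] by (simp flip: matrix_transpose_mul)
  then have "pullback ?K (pullback P G) = G" for G
    by (simp add: pullback_def matrix_mul_assoc)
  then show ?thesis using assms(2) by metis
qed

lemma tensor_flat_pullback:
  "pullback P (tensor (flat h (P *v U)) (flat h (P *v V))) =
    tensor (flat (pullback P h) U) (flat (pullback P h) V)"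
proof -
  have "pullback P (tensor u v) = tensor (transpose P *v u) (transpose P *v v)" for u v
    unfolding pullback_def matrix_matrix_mult_def tensor_def transpose_def matrix_vector_mult_def
    by (simp add: vec_eq_iff sum_distrib_left sum_distrib_right mult_ac)
  moreover have "transpose P *v flat h (P *v V) = flat (pullback P h) V" for V
    by (simp add: flat_def pullback_def matrix_vector_mul_assoc matrix_mul_assoc
        del: transpose_matrix_vector)
  ultimately show ?thesis by simp
qed

lemma pullback_add: "pullback P (G + H) = pullback P G + pullback P H"
  by (simp add: pullback_def matrix_add_ldistrib matrix_add_rdistrib)

lemma pullback_scaleR: "pullback P (k *\<^sub>R G) = k *\<^sub>R pullback P G"
  by (simp add: pullback_def matrix_scalar_ac scalar_matrix_assoc)

lemma pullback_minus: "pullback P (- G) = - pullback P G"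
  using pullback_scaleR[of P "- 1" G] by simp

lemma pullback_diff: "pullback P (G - H) = pullback P G - pullback P H"
  using pullback_add[of P G "- H"] by (simp add: pullback_minus)

text \<open>In an oriented orthonormal frame starting with \<open>X\<close> and \<open>W\<close> the
  form is \<open>wrench_form\<close>, where everything has been computed. Naturality carries scalars
  and vectors back, and injectivity of the pullback carries back the metric.\<close>

lemma wrench_tilde_metric:
  assumes h: "lorentzian h" and F: "transpose F = - F" and k: "kappa h F \<noteq> 0"
    and X: "metric_app h X X = 1" and W: "metric_app h W W = - 1" "metric_app h W X = 0"
    and E: "electric h F X = \<alpha> *\<^sub>R W" and B: "magnetic h F X = \<beta> *\<^sub>R W"
  shows "kappa h F = (\<alpha>\<^sup>2 + \<beta>\<^sup>2) / 2"
    and "tilde_metric h F =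
      h - 2 *\<^sub>R tensor (flat h X) (flat h X) + 2 *\<^sub>R tensor (flat h W) (flat h W)"
    and "electric (tilde_metric h F) F W = - \<alpha> *\<^sub>R X"
    and "magnetic (tilde_metric h F) F W = - \<beta> *\<^sub>R X"
proof -
  obtain P where dP: "det P > 0" and Ph: "pullback P h = minkowski"
    and PX: "P *v axis 0 1 = X" and PW: "P *v axis 1 1 = W"
    using oriented_orthonormal_frame[OF h X W] by blast
  have P: "invertible P" using dP by (simp add: invertible_det_nz)
  have ih: "invertible h" using h by (rule lorentzian_invertible)
  have inj: "u = v" if "P *v u = P *v v" for u v
    using arg_cong[OF that, of "(*v) (matrix_inv P)"]
    by (simp add: matrix_vector_mul_assoc matrix_inv_mult(2)[OF P])
  have PF: "pullback P F = wrench_form \<alpha> \<beta>"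
  proof (rule wrench_form_eqI)
    have "transpose (pullback P F) = pullback P (transpose F)"
      by (simp add: pullback_def matrix_transpose_mul matrix_mul_assoc)
    also have "\<dots> = - pullback P F"
      by (simp add: F pullback_minus)
    finally show "transpose (pullback P F) = - pullback P F" .
    have "P *v electric minkowski (pullback P F) (axis 0 1) = P *v (\<alpha> *\<^sub>R axis 1 1)"
      using electric_pullback[OF P ih, of F "axis 0 1"]
      by (simp only: Ph PX PW E matrix_vector_mult_scaleR)
    then show "electric minkowski (pullback P F) (axis 0 1) = \<alpha> *\<^sub>R axis 1 1"
      by (rule inj)
    have "P *v magnetic minkowski (pullback P F) (axis 0 1) = P *v (\<beta> *\<^sub>R axis 1 1)"
      using magnetic_pullback[OF dP ih, of F "axis 0 1"]
      by (simp only: Ph PX PW B matrix_vector_mult_scaleR)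
    then show "magnetic minkowski (pullback P F) (axis 0 1) = \<beta> *\<^sub>R axis 1 1"
      by (rule inj)
  qed
  have k': "kappa minkowski (wrench_form \<alpha> \<beta>) = kappa h F"
    using kappa_pullback[OF dP ih, of F] by (simp add: Ph PF)
  then show "kappa h F = (\<alpha>\<^sup>2 + \<beta>\<^sup>2) / 2"
    by (simp add: wrench_form_kappa)
  let ?t = "tilde_metric h F"
  have Pt: "pullback P ?t = tilde_minkowski"
    using tilde_metric_pullback[OF dP ih, of F] wrench_form_tilde_metric[of \<alpha> \<beta>] k
    by (simp add: Ph PF k')
  show "?t = h - 2 *\<^sub>R tensor (flat h X) (flat h X) + 2 *\<^sub>R tensor (flat h W) (flat h W)"
    using tensor_flat_pullback[of P h "axis 0 1" "axis 0 1"]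
      tensor_flat_pullback[of P h "axis 1 1" "axis 1 1"]
    by - (rule pullback_inject[OF P],
      simp only: pullback_add pullback_diff pullback_scaleR Pt Ph PX PW tilde_minkowski_eq)
  \<comment> \<open>Nondegeneracy is what permits the naturality of the measured fields to be
    applied to the tilde metric itself.\<close>
  have it: "invertible ?t"
  proof -
    have "det (pullback P ?t) \<noteq> 0"
      unfolding Pt by (simp add: tilde_minkowski_def det_diagonal_matrix prod_index4)
    then show ?thesis by (auto simp: invertible_det_nz pullback_def det_mul)
  qed
  show "electric ?t F W = - \<alpha> *\<^sub>R X"
    using electric_pullback[OF P it, of F "axis 1 1"]
    by (simp only: Pt PF wrench_form_tilde_electric PW matrix_vector_mult_scaleR PX)
  show "magnetic ?t F W = - \<beta> *\<^sub>R X"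
    using magnetic_pullback[OF dP it, of F "axis 1 1"]
    by (simp only: Pt PF wrench_form_tilde_magnetic PW matrix_vector_mult_scaleR PX)
qed

section \<open>Comparison of the hydrodynamic quantities\<close>

lemma tensor_scaleR: "tensor (a *\<^sub>R u) (b *\<^sub>R v) = (a * b) *\<^sub>R tensor u v"
  by (simp add: tensor_def vec_eq_iff)

lemma flat_scaleR: "flat h (a *\<^sub>R V) = a *\<^sub>R flat h V"
  by (simp add: flat_def matrix_vector_mult_scaleR)

lemma tensor_mult_vector: "tensor u v *v V = (v \<bullet> V) *\<^sub>R u"
  by (simp add: tensor_def matrix_vector_mult_def inner_vec_def vec_eq_iff sum_distrib_left mult_ac)

text \<open>Parallel electric and magnetic vectors have vanishing wedge product. For a wrench this
  holds along \<open>W\<close> in the original metric and along \<open>X\<close> in the tilde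
  metric.\<close>

lemma heat_flux_eq_0:
  assumes "electric h F Y = \<alpha> *\<^sub>R V" "magnetic h F Y = \<beta> *\<^sub>R V"
  shows "heat_flux h F Y = 0"
proof -
  have "wedge (flat h (electric h F Y)) (flat h (magnetic h F Y)) = 0"
    by (simp add: assms flat_scaleR wedge_def tensor_scaleR mult.commute)
  moreover have "hodge h 0 = 0"
    by (simp add: hodge_def vec_eq_iff)
  ultimately show ?thesis
    by (simp add: heat_flux_def interior_mult_def sharp_def flip: zero_vec_def)
qed

lemma wrench_hydrodynamics:
  assumes h: "lorentzian h" and F: "transpose F = - F" and k: "kappa h F \<noteq> 0"
    and X: "metric_app h X X = 1" and wrench: "wrench_vector h F X W"
  defines "t \<equiv> tilde_metric h F"
    and "l \<equiv> (1 / sqrt 2) *\<^sub>R (X + W)" and "n \<equiv> (1 / sqrt 2) *\<^sub>R (X - W)"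
  shows "energy_density t F W = energy_density h F X"
    and "pressure t F W = pressure h F X"
    and "heat_flux t F W = 0"
    and "heat_flux h F X = 0"
    and "anisotropic_pressure t F W = anisotropic_pressure h F X -
      (4 / 3 * kappa h F) *\<^sub>R (tensor (flat h l) (flat h n) + tensor (flat h n) (flat h l))"
proof -
  obtain \<alpha> \<beta> where W: "metric_app h W W = - 1" "metric_app h W X = 0"
    and E: "electric h F X = \<alpha> *\<^sub>R W" and B: "magnetic h F X = \<beta> *\<^sub>R W"
    using wrench by (auto simp: wrench_vector_def)
  note tilde = wrench_tilde_metric[OF h F k X W E B, folded t_def]
  have XW: "metric_app h X W = 0"
    using W(2) lorentzian_metric_app_commute[OF h] by simp
  note tx = tilde(2)
  have flat_t: "flat t V = flat h V - (2 * metric_app h V X) *\<^sub>R flat h X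
      + (2 * metric_app h V W) *\<^sub>R flat h W" for V
    unfolding tx
    by (simp add: flat_def matrix_vector_mult_add_rdistrib matrix_vector_mult_diff_rdistrib
        tensor_mult_vector metric_app_eq_inner inner_commute flip: scaleR_matrix_vector_assoc)
  \<comment> \<open>Both signs flip, as \<open>h\<close> takes the value 1 on \<open>X\<close> and
    -1 on \<open>W\<close>. Tensor products of these covectors with themselves are therefore the
    same for both metrics.\<close>
  have tX: "flat t X = - flat h X" and tW: "flat t W = - flat h W"
    by (simp_all add: flat_t X W XW vec_eq_iff)
  have app: "metric_app h' (a *\<^sub>R V) (a *\<^sub>R V) = a\<^sup>2 * metric_app h' V V" for h' a V
    by (simp add: metric_app_eq_inner matrix_vector_mult_scaleR power2_eq_square)
  \<comment> \<open>\<open>X\<close> is a unit spacelike vector for the tilde metric, so the fields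
    -\<alpha> X and -\<beta> X have the same squared strengths there as \<alpha> W and \<beta> W
    have in \<open>h\<close>.\<close>
  have "metric_app t X X = - 1"
    using X tX by (simp add: metric_app_eq_inner flat_def)
  then have sq: "electric_sq h F X = \<alpha>\<^sup>2" "magnetic_sq h F X = \<beta>\<^sup>2"
    "electric_sq t F W = \<alpha>\<^sup>2" "magnetic_sq t F W = \<beta>\<^sup>2"
    by (simp_all only: electric_sq_def magnetic_sq_def E B tilde(3,4) app W(1)) simp_all
  show "energy_density t F W = energy_density h F X" "pressure t F W = pressure h F X"
    by (simp_all only: energy_density_def pressure_def sq)
  show "heat_flux h F X = 0" using E B by (rule heat_flux_eq_0)
  show "heat_flux t F W = 0" using tilde(3,4) by (rule heat_flux_eq_0)
  \<comment> \<open>The mixed products of \<open>X\<close> and \<open>W\<close> cancel, and the two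
    factors \<open>1 / sqrt 2\<close> compensate for the doubling of the others.\<close>
  have ln: "tensor (flat h l) (flat h n) + tensor (flat h n) (flat h l) =
      tensor (flat h X) (flat h X) - tensor (flat h W) (flat h W)"
    unfolding l_def n_def flat_scaleR tensor_scaleR
    by (simp add: vec_eq_iff tensor_def flat_def matrix_vector_right_distrib
        matrix_vector_mult_diff_distrib algebra_simps)
  \<comment> \<open>With \<alpha>^2 + \<beta>^2 = 2 \<kappa>, the change in the field terms is -2
    \<kappa> times the difference of the squares of the covectors of \<open>X\<close> and
    \<open>W\<close>. The change in the projectors adds 2/3 \<kappa> times it, which leaves the
    coefficient -4/3 \<kappa>.\<close>
  show "anisotropic_pressure t F W = anisotropic_pressure h F X -
      (4 / 3 * kappa h F) *\<^sub>R (tensor (flat h l) (flat h n) + tensor (flat h n) (flat h l))"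
    unfolding ln tilde(1) anisotropic_pressure_def sq projector_def E B tilde(3,4) flat_scaleR
      tensor_scaleR tX tW
    unfolding tx
    by (simp add: vec_eq_iff tensor_def power2_eq_square field_simps)
qed

theorem mainTheorem7:
  fixes M :: "'a topology" and A :: "'a chart set"
    and g gt F :: "'a tensor_comps" and T X W l n :: "'a vector_comps"
  assumes "spacetime M A g T"
    and "regular_2_form A g F"
    and "\<And>c x. gt c x = tilde_metric (g c x) (F c x)"
    and "wrench_observer_field A g T F X W"
    and "\<And>c x. l c x = (1 / sqrt 2) *\<^sub>R (X c x + W c x)"
    and "\<And>c x. n c x = (1 / sqrt 2) *\<^sub>R (X c x - W c x)"
  shows "\<forall>c\<in>A. \<forall>x\<in>fst c.
      energy_density (gt c x) (F c x) (W c x) = energy_density (g c x) (F c x) (X c x) \<and>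
      pressure (gt c x) (F c x) (W c x) = pressure (g c x) (F c x) (X c x) \<and>
      heat_flux (gt c x) (F c x) (W c x) = heat_flux (g c x) (F c x) (X c x) \<and>
      heat_flux (g c x) (F c x) (X c x) = 0 \<and>
      anisotropic_pressure (gt c x) (F c x) (W c x) =
        anisotropic_pressure (g c x) (F c x) (X c x)
        - (4 / 3 * kappa (g c x) (F c x)) *\<^sub>R
            (tensor (flat (g c x) (l c x)) (flat (g c x) (n c x)) +
             tensor (flat (g c x) (n c x)) (flat (g c x) (l c x)))"
proof (intro ballI)
  fix c x assume cx: "c \<in> A" "x \<in> fst c"
  have h: "lorentzian (g c x)"
    using assms(1) cx by (auto simp: spacetime_def)
  have F: "transpose (F c x) = - F c x" "kappa (g c x) (F c x) \<noteq> 0"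
    using assms(2) cx by (auto simp: regular_2_form_def smooth_2_form_def)
  have X: "metric_app (g c x) (X c x) (X c x) = 1"
      "wrench_vector (g c x) (F c x) (X c x) (W c x)"
    using assms(4) cx by (auto simp: wrench_observer_field_def observer_field_def)
  show "energy_density (gt c x) (F c x) (W c x) = energy_density (g c x) (F c x) (X c x) \<and>
      pressure (gt c x) (F c x) (W c x) = pressure (g c x) (F c x) (X c x) \<and>
      heat_flux (gt c x) (F c x) (W c x) = heat_flux (g c x) (F c x) (X c x) \<and>
      heat_flux (g c x) (F c x) (X c x) = 0 \<and>
      anisotropic_pressure (gt c x) (F c x) (W c x) =
        anisotropic_pressure (g c x) (F c x) (X c x)
        - (4 / 3 * kappa (g c x) (F c x)) *\<^sub>R
            (tensor (flat (g c x) (l c x)) (flat (g c x) (n c x)) +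
             tensor (flat (g c x) (n c x)) (flat (g c x) (l c x)))"
    unfolding assms(3,5,6) using wrench_hydrodynamics[OF h F X] by (simp only: simp_thms)
qed

end
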